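(* Let $\kappa\in\mathbb{N}$ be even and let $G$ be a $\kappa$-connected graph of order $n$. (a) If $I$ is a nondecreasing distance-based topological index, then \[ I(G)\le I(C_n^{\kappa/2}). \] (b) If $\kappa=2$ and $I$ is an increasing distance-based topological index, then \[ I(G)\le I(C_n^{\kappa/2}), \] with equality if and only if $G$ is a cycle. (c) Corresponding statements hold if $I$ is nonincreasing or decreasing: if $I$ is a nonincreasing distance-based topological index, then $I(G)\ge I(C_n^{\kappa/2})$; and if $\kappa=2$ and $I$ is a decreasing distance-based topological index, then $I(G)\ge I(C_n^{\kappa/2})$, with equality if and only if $G$ is a cycle.
   Context: All graphs are finite and simple, and $\mathbb{N}$ denotes the positive integers. The order of a graph is its number of vertices. A graph $G$ is $k$-connected if it has more than $k$ vertices and $G-S$ is connected whenever $S$ is a set of fewer than $k$ vertices. $C_n$ is the cycle on $n$ vertices. The $k$-th power $G^k$ of a graph $G$ is the graph on the same vertex set in which two distinct vertices are adjacent if their distance in $G$ is at most $k$. For a connected graph $G$, $d_G(u,v)$ is the usual shortest-path distance. The distance sequence $\mathcal{D}(G)$ of a connected graph $G$ is the nondecreasing sequence (of length $\binom{n}{2}$ if $G$ has order $n$) of the distances between all unordered pairs of distinct vertices of $G$, with repetitions. A topological index $I$, assigning a real number to each connected graph, is distance-based if it can be expressed in the form $I(G)=g(\mathcal{D}(G))$, where $g$ is a real-valued function defined on the set of all finite sequences of positive integers. It is called increasing (decreasing, nonincreasing, nondecreasing) if $g$, when restricted to sequences of any fixed length, is increasing (decreasing, nonincreasing, nondecreasing)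 in every coordinate, where increasing and decreasing are meant strictly. *)

theory Defs
  imports "Graph_Theory.Graph_Theory" "HOL-Library.Multiset"
begin

text \<open>
  A finite simple graph is a symmetric, loop-free digraph whose arcs are pairs of vertices, that is,
  some \<open>G :: 'a pair_pre_digraph\<close> with \<^const>\<open>pair_graph\<close> \<open>G\<close>. An undirected edge \<open>uv\<close> is represented
  by the two arcs \<open>(u, v)\<close> and \<open>(v, u)\<close>. The coercion \<^const>\<open>with_proj\<close> into the general digraph type
  is inserted implicitly.
\<close>

text \<open>The value is meaningful only if \<open>v\<close> is reachable from \<open>u\<close>.\<close>

definition gdist :: "'a pair_pre_digraph \<Rightarrow> 'a \<Rightarrow> 'a \<Rightarrow> nat" where
  "gdist G u v = (LEAST d. \<exists>p. pre_digraph.apath G u p v \<and> length p = d)"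

definition k_connected :: "nat \<Rightarrow> 'a pair_pre_digraph \<Rightarrow> bool" where
  "k_connected k G \<longleftrightarrow> k < card (pverts G) \<and>
     (\<forall>S. S \<subseteq> pverts G \<and> card S < k \<longrightarrow> Digraph_Component.connected (G \<restriction> (pverts G - S)))"

definition graph_power :: "'a pair_pre_digraph \<Rightarrow> nat \<Rightarrow> 'a pair_pre_digraph" where
  "graph_power G k = \<lparr> pverts = pverts G,
     parcs = {(u, v). u \<in> pverts G \<and> v \<in> pverts G \<and> u \<noteq> v \<and> u \<rightarrow>\<^sup>*\<^bsub>G\<^esub> v \<and> gdist G u v \<le> k} \<rparr>"

text \<open>The following digraph is a simple graph, namely the cycle on \<open>n\<close> vertices, if \<open>n \<ge> 3\<close>.\<close>

definition cycle_graph :: "nat \<Rightarrow> nat pair_pre_digraph" where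
  "cycle_graph n = \<lparr> pverts = {..<n},
     parcs = {(i, j). i < n \<and> j < n \<and> (j = (i + 1) mod n \<or> i = (j + 1) mod n)} \<rparr>"

text \<open>\<open>C\<close> is a copy of the cycle on \<open>n\<close> vertices, with vertices taken from an arbitrary type.\<close>

definition is_cycle_graph :: "nat \<Rightarrow> 'a pair_pre_digraph \<Rightarrow> bool" where
  "is_cycle_graph n C \<longleftrightarrow> 3 \<le> n \<and> digraph_iso (cycle_graph n) C"

text \<open>
  The distance in a graph is symmetric, so the description below determines the distance of an
  unordered pair of vertices; see \<open>pair_gdist_eq\<close>.
\<close>

definition pair_gdist :: "'a pair_pre_digraph \<Rightarrow> 'a set \<Rightarrow> nat" where
  "pair_gdist G e = (THE d. \<exists>u v. e = {u, v} \<and> u \<noteq> v \<and> d = gdist G u v)"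

definition distance_sequence :: "'a pair_pre_digraph \<Rightarrow> nat list" where
  "distance_sequence G = sorted_list_of_multiset
     (image_mset (pair_gdist G) (mset_set {e. e \<subseteq> pverts G \<and> card e = 2}))"

text \<open>
  \<open>g\<close> is evaluated on arbitrary, not necessarily sorted, finite sequences of positive integers.
  Increasing one coordinate of such a sequence changes the value of \<open>g\<close> in the sense of \<open>R\<close>.
\<close>

definition coordinatewise :: "(real \<Rightarrow> real \<Rightarrow> bool) \<Rightarrow> (nat list \<Rightarrow> real) \<Rightarrow> bool" where
  "coordinatewise R g \<longleftrightarrow>
     (\<forall>xs i y. (\<forall>x\<in>set xs. 0 < x) \<and> i < length xs \<and> xs ! i < y \<longrightarrow> R (g xs) (g (xs[i := y])))"

definition represents_index ::
    "(nat list \<Rightarrow> real) \<Rightarrow> ('a pair_pre_digraph \<Rightarrow> real) \<Rightarrow> bool" where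
  "represents_index g I \<longleftrightarrow>
     (\<forall>G. pair_graph G \<and> Digraph_Component.connected G \<longrightarrow> I G = g (distance_sequence G))"

definition nondecreasing_index :: "('a pair_pre_digraph \<Rightarrow> real) \<Rightarrow> bool" where
  "nondecreasing_index I \<longleftrightarrow> (\<exists>g. represents_index g I \<and> coordinatewise (\<le>) g)"

definition increasing_index :: "('a pair_pre_digraph \<Rightarrow> real) \<Rightarrow> bool" where
  "increasing_index I \<longleftrightarrow> (\<exists>g. represents_index g I \<and> coordinatewise (<) g)"

definition nonincreasing_index :: "('a pair_pre_digraph \<Rightarrow> real) \<Rightarrow> bool" where
  "nonincreasing_index I \<longleftrightarrow> (\<exists>g. represents_index g I \<and> coordinatewise (\<ge>) g)"

definition decreasing_index :: "('a pair_pre_digraph \<Rightarrow> real) \<Rightarrow> bool" where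
  "decreasing_index I \<longleftrightarrow> (\<exists>g. represents_index g I \<and> coordinatewise (>) g)"

lemma pair_graph_cycle_graph:
  assumes "3 \<le> n"
  shows "pair_graph (cycle_graph n)"
proof
  show "finite (parcs (cycle_graph n))"
    by (rule finite_subset[of _ "{..<n} \<times> {..<n}"]) (auto simp: cycle_graph_def)
  show "symmetric (cycle_graph n)"
    by (auto simp: symmetric_def sym_def cycle_graph_def arcs_ends_def arc_to_ends_def with_proj_def)
  show "fst e \<noteq> snd e" if "e \<in> parcs (cycle_graph n)" for e
    using that assms by (auto simp: cycle_graph_def mod_Suc split: if_splits)
qed (auto simp: cycle_graph_def)

text \<open>Every finite set with at least three elements carries a copy of the cycle of that order.\<close>

lemma ex_is_cycle_graph:
  fixes V :: "'a set"
  assumes "finite V" "3 \<le> card V"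
  shows "\<exists>C. pair_graph C \<and> pverts C = V \<and> is_cycle_graph (card V) C"
proof -
  let ?n = "card V" and ?Z = "cycle_graph (card V)"
  obtain f where f: "bij_betw f {..<?n} V"
    using assms(1) by (metis bij_betw_from_nat_into_finite)
  define C where "C = \<lparr> pverts = V, parcs = map_prod f f ` parcs ?Z \<rparr>"
  interpret Z: pair_graph ?Z using assms(2) by (rule pair_graph_cycle_graph)
  have V: "pverts ?Z = {..<?n}" by (simp add: cycle_graph_def)
  have inj: "inj_on f {..<?n}" and im: "f ` {..<?n} = V"
    using f by (auto simp: bij_betw_def)
  have fV: "f x \<in> V" if "x < ?n" for x
    using that im by blast
  have sub: "parcs ?Z \<subseteq> {..<?n} \<times> {..<?n}" by (auto simp: cycle_graph_def)
  have inj2: "inj_on (map_prod f f) (parcs ?Z)"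
    using map_prod_inj_on[OF inj inj] sub by (rule inj_on_subset)
  let ?h = "\<lparr> iso_verts = f, iso_arcs = map_prod f f, iso_head = snd, iso_tail = fst \<rparr>"
  have "pre_digraph.digraph_isomorphism (with_proj ?Z) ?h"
    using inj inj2 Z.wf_digraph V
    by (auto simp: pre_digraph.digraph_isomorphism_def with_proj_def)
  moreover have "with_proj C = app_iso ?h ?Z"
    using im V by (simp add: C_def with_proj_def app_iso_def)
  ultimately have "is_cycle_graph ?n C"
    using assms(2) by (auto simp: is_cycle_graph_def digraph_iso_def)
  moreover have "pair_graph C"
  proof
    show "finite (pverts C)" using assms(1) by (simp add: C_def)
    show "finite (parcs C)" by (simp add: C_def Z.pair_finite_arcs)
    show "fst e \<in> pverts C" "snd e \<in> pverts C" if "e \<in> parcs C" for e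
      using that sub fV by (auto simp: C_def)
    show "fst e \<noteq> snd e" if "e \<in> parcs C" for e
      using that sub inj Z.pair_no_loops by (fastforce simp: C_def dest: inj_onD)
    have "sym (parcs ?Z)" by (auto simp: cycle_graph_def sym_def)
    then have "sym (parcs C)" by (fastforce simp: C_def sym_def)
    then show "symmetric C"
      by (simp add: symmetric_def)
  qed
  ultimately show ?thesis by (auto simp: C_def)
qed

lemma gdist_sym:
  assumes "pair_graph G"
  shows "gdist G u v = gdist G v u"
proof -
  interpret pair_graph G by fact
  have "\<exists>q. apath b q a \<and> length q = length p" if "apath a p b" for a b p
  proof (intro exI conjI)
    show "apath b (rev_path p) a"
      using that by simp
    show "length (rev_path p) = length p"
      by (induction p) auto
  qed
  then have "(\<exists>p. apath u p v \<and> length p = d) \<longleftrightarrow> (\<exists>p. apath v p u \<and> length p = d)" for d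
    by metis
  then show ?thesis by (simp add: gdist_def)
qed

lemma pair_gdist_eq:
  assumes "pair_graph G" "u \<noteq> v"
  shows "pair_gdist G {u, v} = gdist G u v"
  unfolding pair_gdist_def
proof (rule the_equality)
  show "\<exists>x y. {u, v} = {x, y} \<and> x \<noteq> y \<and> gdist G u v = gdist G x y"
    using assms(2) by blast
  show "d = gdist G u v" if "\<exists>x y. {u, v} = {x, y} \<and> x \<noteq> y \<and> d = gdist G x y" for d
    using that gdist_sym[OF assms(1)] by (metis doubleton_eq_iff)
qed

end

theory Submission
  imports Defs
begin

text \<open>
  In a \<open>\<kappa>\<close>-connected graph of order \<open>n\<close> every sphere around a vertex that is not the last one
  separates, and so has at least \<open>\<kappa>\<close> vertices; hence the ball of radius \<open>k\<close> has at least
  \<open>min n (1 + k * \<kappa>)\<close> vertices. In the \<open>\<kappa>/2\<close>-th power of the cycle this number is an upper bound.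
  Summing over all centres counts the pairs at distance at most \<open>k\<close>, so the sorted distance sequence
  of the graph is dominated coordinatewise by that of the power of the cycle. If \<open>\<kappa> = 2\<close> and the
  sequences agree, then the balls of radius 1 have exactly three vertices, that is, the graph is
  connected and 2-regular, and therefore a cycle.
\<close>

section \<open>Balls and distances\<close>

text \<open>Closed balls grown layer by layer from a bare relation, so that inductions on the radius
  involve neither walks nor \<open>gdist\<close>; \<open>in_rball_iff_gdist\<close> makes the link
  to distances.\<close>

primrec rball :: "'a rel \<Rightarrow> 'a \<Rightarrow> nat \<Rightarrow> 'a set" where
  "rball E u 0 = {u}"
| "rball E u (Suc k) = rball E u k \<union> E `` rball E u k"

lemma rball_mono: "i \<le> j \<Longrightarrow> rball E u i \<subseteq> rball E u j"
  by (rule lift_Suc_mono_le[of "rball E u"]) auto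

lemma centre_in_rball: "u \<in> rball E u k"
  by (induction k) auto

text \<open>The triangle inequality in terms of balls.\<close>

lemma rball_Image:
  assumes "x \<in> rball E u i" "y \<in> rball E x j"
  shows "y \<in> rball E u (i + j)"
  using assms(2)
proof (induction j arbitrary: y)
  case 0
  then show ?case using assms(1) by simp
next
  case (Suc j)
  then show ?case by auto
qed

lemma rball_subset_verts:
  assumes "E \<subseteq> V \<times> V" "u \<in> V"
  shows "rball E u k \<subseteq> V"
  by (induction k) (use assms in auto)

text \<open>Injective relabelling transports balls, so ball sizes in any copy of the cycle can be
  read off in \<open>cycle_graph\<close> itself.\<close>

lemma rball_map_prod:
  assumes "inj_on f V" "E \<subseteq> V \<times> V" "u \<in> V"
  shows "rball (map_prod f f ` E) (f u) k = f ` rball E u k"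
proof (induction k)
  case 0
  then show ?case by simp
next
  case (Suc k)
  have "rball E u k \<subseteq> V"
    using assms by (intro rball_subset_verts)
  \<comment> \<open>Injectivity on \<open>V\<close> pulls membership back: an arc leaving the image
    of the ball comes from an arc leaving the ball.\<close>
  then have iff: "f x \<in> f ` rball E u k \<longleftrightarrow> x \<in> rball E u k" if "(x, y) \<in> E" for x y
    using that assms(1,2) inj_on_image_mem_iff by (metis mem_Sigma_iff subsetD)
  have "(map_prod f f ` E) `` (f ` rball E u k) = f ` (E `` rball E u k)"
  proof (intro equalityI subsetI)
    fix z assume "z \<in> (map_prod f f ` E) `` (f ` rball E u k)"
    then obtain w where w: "w \<in> f ` rball E u k" "(w, z) \<in> map_prod f f ` E"
      by blast
    then obtain x y where xy: "(x, y) \<in> E" "w = f x" "z = f y"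
      by auto
    then have "x \<in> rball E u k"
      using iff w(1) by simp
    with xy show "z \<in> f ` (E `` rball E u k)" by blast
  next
    fix z assume "z \<in> f ` (E `` rball E u k)"
    then obtain x y where xy: "x \<in> rball E u k" "(x, y) \<in> E" "z = f y"
      by blast
    then have "(f x, z) \<in> map_prod f f ` E"
      by force
    then show "z \<in> (map_prod f f ` E) `` (f ` rball E u k)"
      by (rule ImageI) (use xy(1) in simp)
  qed
  then show ?case
    by (simp only: rball.simps Suc image_Un)
qed

section \<open>Balls, walks and distances in a graph\<close>

context pair_graph
begin

text \<open>Each round of \<open>awalk_to_apath\<close> only cuts out a closed piece. This lets
  walks bound \<open>gdist\<close>, which is defined by paths.\<close>

lemma length_awalk_to_apath:
  assumes "awalk u p v"
  shows "length (awalk_to_apath p) \<le> length p"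
  using assms
proof (induct rule: awalk_to_apath_induct)
  case (path p)
  then have "awalk_to_apath p = p"
    by (auto simp: awalk_to_apath.simps)
  then show ?case by simp
next
  case (decomp p q r s)
  then have "awalk_to_apath p = awalk_to_apath (q @ s)"
    using step_awalk_to_apath[of _ p _ q r s] by simp
  moreover have "length (q @ s) \<le> length p"
    using decomp by (auto elim!: awalk_cyc_decompE)
  ultimately show ?case using decomp by simp
qed

lemma in_rball_iff_awalk:
  assumes "u \<in> pverts G"
  shows "v \<in> rball (parcs G) u k \<longleftrightarrow> (\<exists>p. awalk u p v \<and> length p \<le> k)"
proof (induction k arbitrary: v)
  case 0
  then show ?case using assms by (auto simp: awalk_Nil_iff)
next
  case (Suc k)
  show ?case
  proof
    assume "v \<in> rball (parcs G) u (Suc k)"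
    then consider "v \<in> rball (parcs G) u k"
      | w where "w \<in> rball (parcs G) u k" "(w, v) \<in> parcs G" by auto
    then show "\<exists>p. awalk u p v \<and> length p \<le> Suc k"
    proof cases
      case 1
      then show ?thesis using Suc by (meson le_SucI)
    next
      case 2
      then obtain p where "awalk u p w" "length p \<le> k" using Suc by auto
      then have "awalk u (p @ [(w, v)]) v \<and> length (p @ [(w, v)]) \<le> Suc k"
        using 2(2) by (auto simp: awalk_simps dest: in_arcsD2)
      then show ?thesis by blast
    qed
  next
    assume "\<exists>p. awalk u p v \<and> length p \<le> Suc k"
    then obtain p where p: "awalk u p v" "length p \<le> Suc k" by blast
    show "v \<in> rball (parcs G) u (Suc k)"
    \<comment> \<open>The last arc is split off because balls grow at the far end of a walk.\<close>
    proof (cases p rule: rev_cases)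
      case Nil
      then show ?thesis using p centre_in_rball[of u "parcs G" "Suc k"] by (auto simp: awalk_Nil_iff)
    next
      case (snoc q e)
      then have "awalk u q (fst e)" "length q \<le> k" "e \<in> parcs G" "snd e = v"
        using p by (auto simp: awalk_simps)
      then show ?thesis using Suc[of "fst e"] by (cases e) auto
    qed
  qed
qed

text \<open>Reachability is stated separately because \<open>gdist\<close> is a meaningless
  \<open>LEAST\<close> value for unreachable vertices.\<close>

lemma in_rball_iff_gdist:
  assumes "u \<in> pverts G"
  shows "v \<in> rball (parcs G) u k \<longleftrightarrow> u \<rightarrow>\<^sup>*\<^bsub>G\<^esub> v \<and> gdist G u v \<le> k"
proof
  assume "v \<in> rball (parcs G) u k"
  then obtain p where p: "awalk u p v" "length p \<le> k"
    using in_rball_iff_awalk[OF assms] by blast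
  then have "gdist G u v \<le> length (awalk_to_apath p)"
    unfolding gdist_def by (blast intro: Least_le apath_awalk_to_apath)
  then show "u \<rightarrow>\<^sup>*\<^bsub>G\<^esub> v \<and> gdist G u v \<le> k"
    using p length_awalk_to_apath[OF p(1)] by (auto simp: reachable_awalk)
next
  assume *: "u \<rightarrow>\<^sup>*\<^bsub>G\<^esub> v \<and> gdist G u v \<le> k"
  then obtain q where "apath u q v" by (auto simp: reachable_apath)
  then have "\<exists>d p. apath u p v \<and> length p = d" by blast
  then have "\<exists>p. apath u p v \<and> length p = gdist G u v"
    unfolding gdist_def by (rule LeastI_ex)
  then show "v \<in> rball (parcs G) u k"
    using * in_rball_iff_awalk[OF assms] by (auto intro: awalkI_apath)
qed

lemma parcs_subset: "parcs G \<subseteq> pverts G \<times> pverts G"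
  by (auto dest: in_arcsD1 in_arcsD2)

lemma induce_pverts: "with_proj G \<restriction> pverts G = with_proj G"
  using parcs_subset by (auto simp: induce_subgraph_def with_proj_def)

end

section \<open>Connectedness\<close>

text \<open>Induction along a path inside \<open>W\<close>, which can never leave \<open>A\<close>.
  It serves both the separator argument and the proof that a closed walk covers the graph.\<close>

lemma connected_induce_closed:
  fixes G :: "'a pair_pre_digraph"
  assumes "pair_graph G" "Digraph_Component.connected (G \<restriction> W)"
    and "u \<in> A" "u \<in> W" and closed: "\<And>x y. x \<in> A \<Longrightarrow> (x, y) \<in> parcs G \<Longrightarrow> y \<in> W \<Longrightarrow> y \<in> A"
  shows "W \<subseteq> A"
proof
  interpret pair_graph G by fact
  fix v assume "v \<in> W"
  then have "u \<rightarrow>\<^sup>*\<^bsub>mk_symmetric (G \<restriction> W)\<^esub> v"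
    using assms(2,4) unfolding Digraph_Component.connected_def strongly_connected_def by auto
  then have "(u, v) \<in> (parcs (mk_symmetric (G \<restriction> W)))\<^sup>*"
    by (auto simp: reachable_def dest: rtrancl_on_rtranclI)
  then show "v \<in> A"
  proof induction
    case base
    then show ?case by (fact assms(3))
  next
    case (step x y)
    then have "(x, y) \<in> parcs G \<and> y \<in> W"
      by (auto simp: mk_symmetric_def intro: arcs_symmetric)
    then show ?case using step closed by blast
  qed
qed

text \<open>The arc set is already symmetric, so the symmetric closure in the definition of
  connectedness changes nothing.\<close>

lemma connected_iff_reachable:
  assumes "pair_graph G"
  shows "Digraph_Component.connected G \<longleftrightarrow>
    pverts G \<noteq> {} \<and> (\<forall>u\<in>pverts G. \<forall>v\<in>pverts G. u \<rightarrow>\<^sup>*\<^bsub>G\<^esub> v)"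
proof -
  interpret pair_graph G by fact
  have "parcs (mk_symmetric G) = parcs G"
    by (auto simp: mk_symmetric_def intro: arcs_symmetric)
  then have "mk_symmetric G = G"
    by simp
  then show ?thesis
    by (simp add: Digraph_Component.connected_def strongly_connected_def)
qed

lemma k_connected_imp_connected:
  assumes "pair_graph G" "k_connected k G" "0 < k"
  shows "Digraph_Component.connected G"
proof -
  interpret pair_graph G by fact
  have "Digraph_Component.connected (G \<restriction> (pverts G - {}))"
    using assms(2,3) unfolding k_connected_def by (metis card.empty empty_subsetI)
  then show ?thesis by (simp only: Diff_empty induce_pverts)
qed

text \<open>
  If a ball is not everything, its outermost sphere separates its interior from the rest, and
  hence has at least \<open>\<kappa>\<close> vertices.
\<close>

lemma k_connected_card_rball:
  assumes "pair_graph G" "k_connected \<kappa> G" "u \<in> pverts G"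
  shows "min (card (pverts G)) (1 + k * \<kappa>) \<le> card (rball (parcs G) u k)"
proof (induction k)
  case 0
  then show ?case by simp
next
  case (Suc k)
  interpret pair_graph G by fact
  let ?B = "rball (parcs G) u"
  have sub: "?B i \<subseteq> pverts G" for i
    using parcs_subset assms(3) by (rule rball_subset_verts)
  show ?case
  proof (cases "?B (Suc k) = pverts G")
    case True
    then show ?thesis by simp
  next
    case False
    define S where "S = ?B (Suc k) - ?B k"
    have "S \<subseteq> pverts G" using sub[of "Suc k"] by (auto simp: S_def)
    have BSuc: "?B (Suc k) = ?B k \<union> S" by (auto simp: S_def)
    have "\<kappa> \<le> card S"
    proof (rule ccontr)
      assume "\<not> \<kappa> \<le> card S"
      then have "Digraph_Component.connected (G \<restriction> (pverts G - S))"
        using assms(2) \<open>S \<subseteq> pverts G\<close> by (auto simp: k_connected_def)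
      \<comment> \<open>An arc leaving the ball of radius \<open>k\<close> ends in \<open>S\<close>,
        so within the connected graph without \<open>S\<close> the ball cannot be left.\<close>
      then have "pverts G - S \<subseteq> ?B k"
      proof (rule connected_induce_closed[OF assms(1)])
        show "u \<in> ?B k" by (rule centre_in_rball)
        then show "u \<in> pverts G - S" using assms(3) by (simp add: S_def)
      qed (auto simp: S_def)
      then show False using False sub[of "Suc k"] BSuc by blast
    qed
    moreover have "card (?B (Suc k)) = card (?B k) + card S"
      unfolding BSuc using sub finite_subset[OF _ pair_finite_verts] \<open>S \<subseteq> pverts G\<close>
      by (intro card_Un_disjoint) (auto simp: S_def)
    \<comment> \<open>The smaller ball is proper, so the minimum in the induction hypothesis must be
      \<open>1 + k * \<kappa>\<close>.\<close>
    moreover have "card (?B k) < card (pverts G)"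
      using sub[of k] sub[of "Suc k"] False rball_mono[of k "Suc k" "parcs G" u]
      by (intro psubset_card_mono pair_finite_verts) (auto simp del: rball.simps)
    ultimately show ?thesis using Suc by simp
  qed
qed

section \<open>Cycles\<close>

text \<open>Arcs are pairs, so the arc, head and tail maps of a digraph isomorphism are all
  determined by its vertex map; a vertex bijection is easier to handle.\<close>

lemma is_cycle_graph_iff:
  "is_cycle_graph n C \<longleftrightarrow> 3 \<le> n \<and> (\<exists>f. bij_betw f {..<n} (pverts C) \<and>
    parcs C = map_prod f f ` parcs (cycle_graph n))"
proof (cases "3 \<le> n")
  case True
  let ?Z = "cycle_graph n"
  interpret Z: pair_graph ?Z using True by (rule pair_graph_cycle_graph)
  have V: "pverts ?Z = {..<n}" by (simp add: cycle_graph_def)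
  have "digraph_iso ?Z C \<longleftrightarrow> (\<exists>f. bij_betw f {..<n} (pverts C) \<and> parcs C = map_prod f f ` parcs ?Z)"
  proof
    assume "digraph_iso ?Z C"
    then obtain h where h: "pre_digraph.digraph_isomorphism (with_proj ?Z) h"
      and C: "with_proj C = app_iso h ?Z"
      by (auto simp: digraph_iso_def)
    have "fst = iso_tail h" "snd = iso_head h" "pverts C = iso_verts h ` {..<n}"
      and arcs: "parcs C = iso_arcs h ` parcs ?Z"
      using C V by (auto simp: with_proj_def app_iso_def)
    moreover have "iso_arcs h a = map_prod (iso_verts h) (iso_verts h) a" if "a \<in> parcs ?Z" for a
      using h that \<open>fst = iso_tail h\<close> \<open>snd = iso_head h\<close>
      by (cases a) (auto simp: pre_digraph.digraph_isomorphism_def prod_eq_iff)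
    moreover have "inj_on (iso_verts h) {..<n}"
      using h V by (auto simp: pre_digraph.digraph_isomorphism_def)
    ultimately show "\<exists>f. bij_betw f {..<n} (pverts C) \<and> parcs C = map_prod f f ` parcs ?Z"
      by (intro exI[of _ "iso_verts h"]) (auto simp: bij_betw_def intro!: image_cong)
  next
    assume "\<exists>f. bij_betw f {..<n} (pverts C) \<and> parcs C = map_prod f f ` parcs ?Z"
    then obtain f where f: "bij_betw f {..<n} (pverts C)" and E: "parcs C = map_prod f f ` parcs ?Z"
      by blast
    have inj: "inj_on f {..<n}" and im: "f ` {..<n} = pverts C"
      using f by (auto simp: bij_betw_def)
    have sub: "parcs ?Z \<subseteq> {..<n} \<times> {..<n}" by (auto simp: cycle_graph_def)
    have inj2: "inj_on (map_prod f f) (parcs ?Z)"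
      using map_prod_inj_on[OF inj inj] sub by (rule inj_on_subset)
    let ?h = "\<lparr> iso_verts = f, iso_arcs = map_prod f f, iso_head = snd, iso_tail = fst \<rparr>"
    have "pre_digraph.digraph_isomorphism (with_proj ?Z) ?h"
      using inj inj2 Z.wf_digraph V
      by (auto simp: pre_digraph.digraph_isomorphism_def with_proj_def)
    moreover have "with_proj C = app_iso ?h ?Z"
      using im V E by (simp add: with_proj_def app_iso_def)
    ultimately show "digraph_iso ?Z C"
      by (auto simp: digraph_iso_def)
  qed
  with True show ?thesis by (simp add: is_cycle_graph_def)
qed (simp add: is_cycle_graph_def)

text \<open>Each arc shifts the position by plus or minus one modulo \<open>n\<close>. Integers are
  used because the total offset \<open>t\<close> may be negative.\<close>

lemma rball_cycle_graph:
  assumes "i < n" "j \<in> rball (parcs (cycle_graph n)) i k"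
  shows "\<exists>t\<in>{- int k..int k}. int j = (int i + t) mod int n"
  using assms(2)
proof (induction k arbitrary: j)
  case 0
  then show ?case using assms(1) by simp
next
  case (Suc k)
  then consider "j \<in> rball (parcs (cycle_graph n)) i k"
    | l where "l \<in> rball (parcs (cycle_graph n)) i k" "(l, j) \<in> parcs (cycle_graph n)"
    by auto
  then show ?case
  proof cases
    case 1
    then obtain t where "t \<in> {- int k..int k}" "int j = (int i + t) mod int n"
      using Suc.IH by blast
    then show ?thesis by (intro bexI[of _ t]) auto
  next
    case 2
    then obtain t where t: "t \<in> {- int k..int k}" "int l = (int i + t) mod int n"
      using Suc.IH by blast
    have lj: "l < n" "j < n" "j = (l + 1) mod n \<or> l = (j + 1) mod n"
      using 2(2) by (auto simp: cycle_graph_def)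
    then show ?thesis
    proof (elim disjE)
      assume "j = (l + 1) mod n"
      then have "int j = (int l + 1) mod int n" by (simp add: zmod_int ac_simps)
      also have "\<dots> = (int i + (t + 1)) mod int n"
        by (simp add: t(2) mod_simps algebra_simps)
      finally show ?thesis using t(1) by (intro bexI[of _ "t + 1"]) auto
    next
      assume "l = (j + 1) mod n"
      then have "int l = (int j + 1) mod int n" by (simp add: zmod_int ac_simps)
      then have "(int l - 1) mod int n = int j mod int n"
        by (simp add: mod_simps)
      then have "int j = (int l - 1) mod int n" using lj(2) by simp
      also have "\<dots> = (int i + (t - 1)) mod int n"
        by (simp add: t(2) mod_simps algebra_simps)
      finally show ?thesis using t(1) by (intro bexI[of _ "t - 1"]) auto
    qed
  qed
qed

text \<open>There are \<open>2 * k + 1\<close> offsets between \<open>- k\<close> and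
  \<open>k\<close>.\<close>

lemma card_rball_cycle_graph:
  assumes "i < n"
  shows "card (rball (parcs (cycle_graph n)) i k) \<le> 1 + 2 * k"
proof -
  have "rball (parcs (cycle_graph n)) i k \<subseteq> (\<lambda>t. nat ((int i + t) mod int n)) ` {- int k..int k}"
    using rball_cycle_graph[OF assms] by (force simp: image_iff)
  then have "card (rball (parcs (cycle_graph n)) i k) \<le> card {- int k..int k}"
    by (rule surj_card_le[rotated]) simp
  then show ?thesis by simp
qed

lemma is_cycle_graph_card:
  assumes "is_cycle_graph n C"
  shows "card (pverts C) = n"
proof -
  obtain f where "bij_betw f {..<n} (pverts C)"
    using assms by (auto simp: is_cycle_graph_iff)
  then show ?thesis using bij_betw_same_card by fastforce
qed

lemma is_cycle_graph_card_rball: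
  assumes "is_cycle_graph n C" "u \<in> pverts C"
  shows "card (rball (parcs C) u k) \<le> 1 + 2 * k"
proof -
  obtain f where f: "bij_betw f {..<n} (pverts C)" "parcs C = map_prod f f ` parcs (cycle_graph n)"
    using assms(1) by (auto simp: is_cycle_graph_iff)
  then obtain i where i: "i < n" "u = f i"
    using assms(2) unfolding bij_betw_def by blast
  have "rball (parcs C) u k = f ` rball (parcs (cycle_graph n)) i k"
    unfolding f(2) i(2) using f(1) i(1)
    by (intro rball_map_prod[of f "{..<n}"]) (auto simp: bij_betw_def cycle_graph_def)
  moreover have "finite (rball (parcs (cycle_graph n)) i k)"
    by (rule finite_subset[OF rball_subset_verts[of _ "{..<n}"]]) (use i in \<open>auto simp: cycle_graph_def\<close>)
  ultimately have "card (rball (parcs C) u k) \<le> card (rball (parcs (cycle_graph n)) i k)"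
    by (simp add: card_image_le)
  then show ?thesis using card_rball_cycle_graph[OF i(1), of k] by simp
qed

lemma sum_card_rball_is_cycle_graph:
  assumes "is_cycle_graph n C"
  shows "(\<Sum>u\<in>pverts C. card (rball (parcs C) u k))
    = (\<Sum>i<n. card (rball (parcs (cycle_graph n)) i k))"
proof -
  obtain f where f: "bij_betw f {..<n} (pverts C)" "parcs C = map_prod f f ` parcs (cycle_graph n)"
    using assms(1) by (auto simp: is_cycle_graph_iff)
  have inj: "inj_on f {..<n}" using f(1) by (auto simp: bij_betw_def)
  have sub: "parcs (cycle_graph n) \<subseteq> {..<n} \<times> {..<n}" by (auto simp: cycle_graph_def)
  have "card (rball (parcs (cycle_graph n)) i k) = card (rball (parcs C) (f i) k)" if "i < n" for i
  proof -
    have "rball (parcs C) (f i) k = f ` rball (parcs (cycle_graph n)) i k"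
      unfolding f(2) using that by (intro rball_map_prod[OF inj sub]) auto
    moreover have "inj_on f (rball (parcs (cycle_graph n)) i k)"
      by (rule inj_on_subset[OF inj rball_subset_verts[OF sub]]) (use that in auto)
    ultimately show ?thesis by (simp add: card_image)
  qed
  then show ?thesis
    using sum.reindex_bij_betw[OF f(1), of "\<lambda>u. card (rball (parcs C) u k)"] by simp
qed

text \<open>The forward arcs alone lead from \<open>f 0\<close> to every vertex; symmetry and
  transitivity do the rest.\<close>

lemma is_cycle_graph_connected:
  assumes "pair_graph C" "is_cycle_graph n C"
  shows "Digraph_Component.connected C"
proof -
  interpret pair_graph C by fact
  obtain f where f: "bij_betw f {..<n} (pverts C)" "parcs C = map_prod f f ` parcs (cycle_graph n)"
    and n: "3 \<le> n"
    using assms(2) by (auto simp: is_cycle_graph_iff)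
  have im: "f ` {..<n} = pverts C" using f(1) by (simp add: bij_betw_def)
  have "f 0 \<rightarrow>\<^sup>*\<^bsub>C\<^esub> f i" if "i < n" for i
    using that
  proof (induction i)
    case 0
    then have "f 0 \<in> pverts C" using im by blast
    then show ?case by simp
  next
    case (Suc i)
    then have "(i, Suc i) \<in> parcs (cycle_graph n)" by (simp add: cycle_graph_def)
    then have "(f i, f (Suc i)) \<in> parcs C" unfolding f(2) by force
    then show ?case using Suc by (auto intro: reachable_adj_trans)
  qed
  then have "f 0 \<rightarrow>\<^sup>*\<^bsub>C\<^esub> v" if "v \<in> pverts C" for v
    using that unfolding im[symmetric] by blast
  moreover have "pverts C \<noteq> {}" using im n by (auto simp: lessThan_empty_iff)
  ultimately show ?thesis
    unfolding connected_iff_reachable[OF assms(1)]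
    by (meson reachable_trans symmetric_reachable')
qed

text \<open>
  Walk along the graph without turning back. The first repeated vertex must be the start, since
  any other vertex of the walk already has its two neighbours on it.
\<close>

lemma two_regular_connected_is_cycle_graph:
  assumes "pair_graph G" "Digraph_Component.connected G"
    and deg: "\<And>u. u \<in> pverts G \<Longrightarrow> card (parcs G `` {u}) = 2"
  shows "is_cycle_graph (card (pverts G)) G"
proof -
  interpret pair_graph G by fact
  let ?E = "parcs G"
  have sym: "(b, a) \<in> ?E" if "(a, b) \<in> ?E" for a b using that by (rule arcs_symmetric)
  have nbr: "z = x \<or> z = y"
    if "(b, x) \<in> ?E" "(b, y) \<in> ?E" "x \<noteq> y" "(b, z) \<in> ?E" for b x y z
  proof (rule ccontr)
    assume "\<not> (z = x \<or> z = y)"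
    then have "card {x, y, z} = 3" using that(3) by auto
    moreover have "card {x, y, z} \<le> card (?E `` {b})"
      using that deg[of b] by (intro card_mono) (auto dest: in_arcsD1 intro: card_ge_0_finite)
    ultimately show False using deg[of b] that in_arcsD1 by fastforce
  qed
  \<comment> \<open>Of the two neighbours of \<open>b\<close> at least one differs from
    \<open>a\<close>, so a walk can always continue without turning back.\<close>
  have step: "\<exists>z. (b, z) \<in> ?E \<and> z \<noteq> a" if "b \<in> pverts G" for a b
  proof (rule ccontr)
    assume "\<not> ?thesis"
    then have "?E `` {b} \<subseteq> {a}" by auto
    then have "card (?E `` {b}) \<le> 1" using card_mono[of "{a}"] by fastforce
    then show False using deg[OF that] by simp
  qed
  obtain a where "a \<in> pverts G"
    using assms(2) connected_iff_reachable[OF assms(1)] by blast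
  then obtain e where "e \<in> ?E" using step by blast
  \<comment> \<open>The sequence consists of arcs instead of vertices: not turning back then relates
    only consecutive terms, as dependent choice requires.\<close>
  then have "\<exists>s. \<forall>i. s i \<in> ?E \<and> (fst (s (Suc i)) = snd (s i) \<and> snd (s (Suc i)) \<noteq> fst (s i))"
    using step[OF in_arcsD2] by (intro dependent_nat_choice) fastforce+
  then obtain s where s: "\<And>i. s i \<in> ?E" "\<And>i. fst (s (Suc i)) = snd (s i)"
    "\<And>i. snd (s (Suc i)) \<noteq> fst (s i)" by blast
  define f where "f i = fst (s i)" for i
  have arc: "(f i, f (Suc i)) \<in> ?E" for i
    using s(1)[of i] s(2)[of i] by (simp add: f_def)
  have noturn: "f (Suc (Suc i)) \<noteq> f i" for i
    using s(2)[of "Suc i"] s(3)[of i] by (simp add: f_def)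
  have fV: "f i \<in> pverts G" for i using arc by (rule in_arcsD1)
  have "\<not> inj f"
    using fV pair_finite_verts by (metis finite_subset image_subsetI finite_imageD infinite_UNIV_nat)
  then have ex: "\<exists>j. \<exists>i<j. f j = f i"
    unfolding inj_def by (metis linorder_neqE_nat)
  \<comment> \<open>The first time at which the walk meets an earlier vertex.\<close>
  define m where "m = (LEAST j. \<exists>i<j. f j = f i)"
  obtain i where i: "i < m" "f m = f i"
    using LeastI_ex[OF ex] by (auto simp: m_def)
  have neq: "f j \<noteq> f l" if "j < m" "l < j" for j l
    using not_less_Least[of j "\<lambda>j. \<exists>i<j. f j = f i"] that by (auto simp: m_def)
  then have inj: "inj_on f {..<m}"
    by (intro inj_onI) (metis lessThan_iff linorder_neqE_nat)
  have "m \<noteq> 0" using i(1) by simp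
  then obtain m' where m': "m = Suc m'" using not0_implies_Suc by blast
  \<comment> \<open>A return after one step would be a loop, and after two steps a turn
    back.\<close>
  have i2: "Suc (Suc i) < m"
  proof -
    have "m \<noteq> Suc i" using arc[of i] i(2) no_loops' by metis
    moreover have "m \<noteq> Suc (Suc i)" using noturn[of i] i(2) by metis
    ultimately show ?thesis using i(1) by simp
  qed
  \<comment> \<open>Otherwise \<open>f m'\<close> is a neighbour of \<open>f i\<close>, hence equal
    to the vertex before or after \<open>f i\<close> on the walk, which contradicts the minimality
    of \<open>m\<close>.\<close>
  have "i = 0"
  proof (rule ccontr)
    assume "i \<noteq> 0"
    then obtain i' where i': "i = Suc i'" using not0_implies_Suc by blast
    have "(f i, f m') \<in> ?E" using sym[OF arc[of m']] m' i(2) by simp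
    moreover have "(f i, f i') \<in> ?E" using sym[OF arc[of i']] i' by simp
    ultimately have "f m' = f i' \<or> f m' = f (Suc i)"
      using nbr[of "f i" "f i'" "f (Suc i)" "f m'"] arc[of i] noturn[of i'] i' by auto
    then show False
      using neq[of m' i'] neq[of m' "Suc i"] i2 i' m' by auto
  qed
  then have fm: "f m = f 0" and m3: "3 \<le> m" using i i2 by auto
  \<comment> \<open>The cyclic predecessor; at \<open>0\<close> it wraps around to
    \<open>m' = m - 1\<close>.\<close>
  define prv where "prv j = (if j = 0 then m' else j - 1)" for j
  have E_iff: "(f j, z) \<in> ?E \<longleftrightarrow> z = f (Suc j) \<or> z = f (prv j)" if "j < m" for j z
  proof -
    have 1: "(f j, f (prv j)) \<in> ?E"
    proof (cases j)
      case 0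
      then show ?thesis using sym[OF arc[of m']] m' fm by (simp add: prv_def)
    next
      case (Suc l)
      then show ?thesis using sym[OF arc[of l]] by (simp add: prv_def)
    qed
    have "f (Suc j) \<noteq> f (prv j)"
    proof (cases j)
      case 0
      then show ?thesis using neq[of m' 1] m3 m' by (simp add: prv_def)
    next
      case (Suc l)
      then show ?thesis using noturn[of l] by (simp add: prv_def)
    qed
    then show ?thesis using nbr[OF arc 1] 1 arc by blast
  qed
  have fSuc: "f (Suc j) = f (Suc j mod m)" if "j < m" for j
    using that fm by (cases "Suc j = m") auto
  have prv: "prv j < m" "Suc (prv j) mod m = j" if "j < m" for j
    using that m' by (auto simp: prv_def)
  \<comment> \<open>Every neighbour of a vertex on the cycle lies on it, so connectedness leaves no
    room for other vertices.\<close>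
  have "pverts G \<subseteq> f ` {..<m}"
  proof (rule connected_induce_closed[OF assms(1), of "pverts G" "f 0"])
    show "Digraph_Component.connected (G \<restriction> pverts G)"
      using assms(2) by (simp only: induce_pverts)
    show "f 0 \<in> f ` {..<m}" using m3 by simp
    show "f 0 \<in> pverts G" by (rule fV)
    fix x y assume "x \<in> f ` {..<m}" "(x, y) \<in> ?E"
    then obtain j where "j < m" "y = f (Suc j mod m) \<or> y = f (prv j)"
      using E_iff fSuc by auto
    then show "y \<in> f ` {..<m}" using prv m3 by auto
  qed
  then have bij: "bij_betw f {..<m} (pverts G)"
    using inj fV by (auto simp: bij_betw_def)
  have "?E = map_prod f f ` parcs (cycle_graph m)"
  proof (intro equalityI subrelI)
    fix x y assume xy: "(x, y) \<in> ?E"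
    then obtain j where j: "j < m" "x = f j"
      using bij in_arcsD1 by (force simp: bij_betw_def)
    then have "y = f (Suc j mod m) \<or> y = f (prv j)" using E_iff fSuc xy by auto
    moreover have "(j, Suc j mod m) \<in> parcs (cycle_graph m)" "(j, prv j) \<in> parcs (cycle_graph m)"
      using j(1) prv m3 by (auto simp: cycle_graph_def)
    ultimately show "(x, y) \<in> map_prod f f ` parcs (cycle_graph m)"
      using j(2) by force
  next
    fix x y assume "(x, y) \<in> map_prod f f ` parcs (cycle_graph m)"
    then obtain j l where jl: "x = f j" "y = f l" "j < m" "l < m" "l = Suc j mod m \<or> j = Suc l mod m"
      by (auto simp: cycle_graph_def)
    then show "(x, y) \<in> ?E"
      using arc[of j] arc[of l] sym fSuc by metis
  qed
  moreover have "card (pverts G) = m" using bij_betw_same_card[OF bij] by simp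
  ultimately show ?thesis using bij m3 by (auto simp: is_cycle_graph_iff)
qed

section \<open>Graph powers\<close>

lemma graph_power_subset_arcs:
  assumes "pair_graph G" "0 < k"
  shows "parcs G \<subseteq> parcs (graph_power G k)"
proof (rule subrelI)
  interpret pair_graph G by fact
  fix u v assume uv: "(u, v) \<in> parcs G"
  then have "v \<in> rball (parcs G) u 1" by auto
  then have "u \<rightarrow>\<^sup>*\<^bsub>G\<^esub> v \<and> gdist G u v \<le> 1" using in_rball_iff_gdist uv in_arcsD1 by blast
  then show "(u, v) \<in> parcs (graph_power G k)"
    using uv assms(2) by (auto simp: graph_power_def dest: in_arcsD1 in_arcsD2 no_loops')
qed

lemma pair_graph_graph_power:
  assumes "pair_graph G"
  shows "pair_graph (graph_power G k)"
proof -
  interpret pair_graph G by fact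
  show ?thesis
  proof
    show "finite (parcs (graph_power G k))"
      by (rule finite_subset[of _ "pverts G \<times> pverts G"])
        (auto simp: graph_power_def pair_finite_verts)
    show "symmetric (graph_power G k)"
      by (auto simp: symmetric_def sym_def graph_power_def gdist_sym[OF assms] symmetric_reachable')
  qed (auto simp: graph_power_def pair_finite_verts)
qed

text \<open>\<open>G\<close> is a spanning subgraph of its power.\<close>

lemma connected_graph_power:
  assumes "pair_graph G" "Digraph_Component.connected G" "0 < k"
  shows "Digraph_Component.connected (graph_power G k)"
proof -
  interpret pair_graph G by fact
  interpret P: pair_graph "graph_power G k" using assms(1) by (rule pair_graph_graph_power)
  have "subgraph G (graph_power G k)"
    using graph_power_subset_arcs[OF assms(1,3)] wf_digraph P.wf_digraph
    by (auto simp: subgraph_def compatible_def graph_power_def)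
  then have "u \<rightarrow>\<^sup>*\<^bsub>graph_power G k\<^esub> v" if "u \<rightarrow>\<^sup>*\<^bsub>G\<^esub> v" for u v
    using P.reachable_mono that by blast
  moreover have "pverts (graph_power G k) = pverts G"
    by (simp add: graph_power_def)
  ultimately show ?thesis
    using assms(2)
    unfolding connected_iff_reachable[OF assms(1)] connected_iff_reachable[OF P.pair_graph]
    by simp
qed

text \<open>One arc of the power covers distance at most \<open>h\<close> in \<open>G\<close>; these
  distances add up by the triangle inequality.\<close>

lemma rball_graph_power:
  assumes "pair_graph G" "u \<in> pverts G"
  shows "rball (parcs (graph_power G h)) u k \<subseteq> rball (parcs G) u (h * k)"
proof (induction k)
  case 0
  then show ?case by simp
next
  case (Suc k)
  interpret pair_graph G by fact
  have "v \<in> rball (parcs G) u (h * Suc k)"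
    if "w \<in> rball (parcs G) u (h * k)" "(w, v) \<in> parcs (graph_power G h)" for v w
  proof -
    have "v \<in> rball (parcs G) w h"
      using that(2) in_rball_iff_gdist[of w v h] by (auto simp: graph_power_def)
    then show ?thesis using rball_Image[OF that(1)] by (simp add: add.commute)
  qed
  moreover have "rball (parcs G) u (h * k) \<subseteq> rball (parcs G) u (h * Suc k)"
    by (rule rball_mono) simp
  ultimately show ?case using Suc by (auto simp del: mult_Suc_right)
qed

lemma graph_power_1:
  assumes "pair_graph G"
  shows "graph_power G 1 = G"
proof -
  interpret pair_graph G by fact
  have "parcs (graph_power G 1) \<subseteq> parcs G"
  proof (rule subrelI)
    fix u v assume "(u, v) \<in> parcs (graph_power G 1)"
    then have "u \<in> pverts G" "u \<rightarrow>\<^sup>*\<^bsub>G\<^esub> v \<and> gdist G u v \<le> 1" "u \<noteq> v"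
      by (auto simp: graph_power_def)
    then have "v \<in> rball (parcs G) u 1"
      using in_rball_iff_gdist by blast
    then show "(u, v) \<in> parcs G" using \<open>u \<noteq> v\<close> by auto
  qed
  then have "parcs (graph_power G 1) = parcs G"
    using graph_power_subset_arcs[OF assms, of 1] by simp
  moreover have "pverts (graph_power G 1) = pverts G"
    by (simp add: graph_power_def)
  ultimately show ?thesis by simp
qed

section \<open>Distance sequences\<close>

text \<open>Double counting: each close pair appears in the balls around both of its members, and
  every ball also contains its centre, which accounts for the summand
  \<open>card (pverts G)\<close>.\<close>

lemma card_pairs_within:
  assumes "pair_graph G" "Digraph_Component.connected G"
  shows "2 * card {e. e \<subseteq> pverts G \<and> card e = 2 \<and> pair_gdist G e \<le> k} + card (pverts G)
    = (\<Sum>u\<in>pverts G. card (rball (parcs G) u k))"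
proof -
  interpret pair_graph G by fact
  let ?V = "pverts G" and ?B = "\<lambda>u. rball (parcs G) u k"
  let ?P = "{e. e \<subseteq> ?V \<and> card e = 2 \<and> pair_gdist G e \<le> k}"
  \<comment> \<open>The two orderings of an unordered pair.\<close>
  let ?S = "\<lambda>e. {(u, v). e = {u, v} \<and> u \<noteq> v}"
  have ball: "v \<in> ?B u \<longleftrightarrow> gdist G u v \<le> k" if "u \<in> ?V" "v \<in> ?V" for u v
    using assms(2) that in_rball_iff_gdist connected_iff_reachable[OF assms(1)] by auto
  have subV: "?B u \<subseteq> ?V" if "u \<in> ?V" for u
    using parcs_subset that by (rule rball_subset_verts)
  have finP: "finite ?P"
    by (rule finite_subset[of _ "Pow ?V"]) (auto simp: pair_finite_verts)
  have S: "finite (?S e) \<and> card (?S e) = 2" if e2: "card e = 2" for e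
  proof -
    obtain a b where ab: "e = {a, b}" "a \<noteq> b" using e2 unfolding card_2_iff by blast
    then have "?S e = {(a, b), (b, a)}" by (auto simp: doubleton_eq_iff)
    then show ?thesis using ab(2) by simp
  qed
  have "(SIGMA u:?V. ?B u - {u}) = (\<Union>e\<in>?P. ?S e)"
  proof (intro equalityI subrelI)
    fix u v assume "(u, v) \<in> (SIGMA u:?V. ?B u - {u})"
    then have "u \<in> ?V" "v \<in> ?V" "u \<noteq> v" "gdist G u v \<le> k" using ball subV by auto
    then have "{u, v} \<in> ?P" "(u, v) \<in> ?S {u, v}" by (auto simp: pair_gdist_eq[OF assms(1)])
    then show "(u, v) \<in> (\<Union>e\<in>?P. ?S e)" by blast
  next
    fix u v assume "(u, v) \<in> (\<Union>e\<in>?P. ?S e)"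
    then show "(u, v) \<in> (SIGMA u:?V. ?B u - {u})"
      using ball by (auto simp: pair_gdist_eq[OF assms(1)])
  qed
  moreover have "card (\<Union>e\<in>?P. ?S e) = (\<Sum>e\<in>?P. card (?S e))"
    using finP S by (intro card_UN_disjoint) auto
  moreover have "(\<Sum>e\<in>?P. card (?S e)) = (\<Sum>e\<in>?P. 2)"
    using S by (intro sum.cong) auto
  moreover have "card (SIGMA u:?V. ?B u - {u}) = (\<Sum>u\<in>?V. card (?B u - {u}))"
    using pair_finite_verts subV by (intro card_SigmaI) (blast intro: finite_subset)+
  moreover have "(\<Sum>u\<in>?V. card (?B u)) = (\<Sum>u\<in>?V. card (?B u - {u}) + 1)"
  proof (rule sum.cong[OF refl])
    fix u assume "u \<in> ?V"
    then have "finite (?B u)" using subV pair_finite_verts by (blast intro: finite_subset)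
    then have "card (insert u (?B u - {u})) = card (?B u - {u}) + 1"
      by (subst card_insert_disjoint) auto
    then show "card (?B u) = card (?B u - {u}) + 1"
      by (simp add: insert_absorb centre_in_rball)
  qed
  ultimately show ?thesis by (simp add: sum_Suc)
qed

text \<open>Counting ignores the sorting. The trivial predicate yields the length, and the predicate
  of being at most \<open>k\<close> the cumulative counts.\<close>

lemma length_filter_distance_sequence:
  assumes "pair_graph G"
  shows "length (filter P (distance_sequence G))
    = card {e. e \<subseteq> pverts G \<and> card e = 2 \<and> P (pair_gdist G e)}"
proof -
  interpret pair_graph G by fact
  let ?A = "{e. e \<subseteq> pverts G \<and> card e = 2}"
  have fin: "finite ?A"
    by (rule finite_subset[of _ "Pow (pverts G)"]) (auto simp: pair_finite_verts)
  have "length (filter P (distance_sequence G)) = size (filter_mset P (mset (distance_sequence G)))"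
    by (metis mset_filter size_mset)
  also have "\<dots> = size (filter_mset (\<lambda>e. P (pair_gdist G e)) (mset_set ?A))"
    by (simp add: distance_sequence_def filter_mset_image_mset)
  also have "\<dots> = card {e \<in> ?A. P (pair_gdist G e)}"
    using fin by (simp add: filter_mset_mset_set)
  finally show ?thesis by (simp add: conj_assoc)
qed

lemma length_distance_sequence:
  assumes "pair_graph G"
  shows "length (distance_sequence G) = card (pverts G) choose 2"
proof -
  interpret pair_graph G by fact
  show ?thesis
    using length_filter_distance_sequence[OF assms, of "\<lambda>_. True"] n_subsets[OF pair_finite_verts]
    by simp
qed

text \<open>A ball of radius 0 contains only its centre. Positivity matters because
  \<open>coordinatewise\<close> constrains \<open>g\<close> on positive sequences only.\<close>

lemma distance_sequence_pos:
  assumes "pair_graph G" "Digraph_Component.connected G" "x \<in> set (distance_sequence G)"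
  shows "0 < x"
proof -
  interpret pair_graph G by fact
  have "finite {e. e \<subseteq> pverts G \<and> card e = 2}"
    by (rule finite_subset[of _ "Pow (pverts G)"]) (auto simp: pair_finite_verts)
  then obtain e where e: "e \<subseteq> pverts G" "card e = 2" "x = pair_gdist G e"
    using assms(3) by (auto simp: distance_sequence_def)
  then obtain u v where uv: "e = {u, v}" "u \<noteq> v" unfolding card_2_iff by blast
  then have "v \<notin> rball (parcs G) u 0" "u \<in> pverts G" "v \<in> pverts G" using e(1) by auto
  moreover have "u \<rightarrow>\<^sup>*\<^bsub>G\<^esub> v"
    using assms(2) calculation(2,3) connected_iff_reachable[OF assms(1)] by blast
  ultimately have "\<not> gdist G u v \<le> 0"
    using in_rball_iff_gdist by blast
  then show ?thesis using e(3) uv by (simp add: pair_gdist_eq[OF assms(1)])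
qed

lemma sorted_list_all2_le:
  fixes xs ys :: "'a :: linorder list"
  assumes "sorted xs" "sorted ys" "length xs = length ys"
    and le: "\<And>k. length (filter (\<lambda>x. x \<le> k) ys) \<le> length (filter (\<lambda>x. x \<le> k) xs)"
  shows "list_all2 (\<le>) xs ys"
proof (rule list_all2_all_nthI)
  fix i assume i: "i < length xs"
  show "xs ! i \<le> ys ! i"
  proof (rule ccontr)
    assume *: "\<not> xs ! i \<le> ys ! i"
    \<comment> \<open>At this threshold \<open>ys\<close> has at least \<open>i + 1\<close> entries,
      but \<open>xs\<close>, being larger from position \<open>i\<close> on, has at most
      \<open>i\<close>.\<close>
    let ?k = "ys ! i"
    have "{..i} \<subseteq> {j. j < length ys \<and> ys ! j \<le> ?k}"
      using i assms(2,3) by (auto intro: sorted_nth_mono)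
    then have "card {..i} \<le> card {j. j < length ys \<and> ys ! j \<le> ?k}"
      by (intro card_mono) auto
    moreover have "{j. j < length xs \<and> xs ! j \<le> ?k} \<subseteq> {..<i}"
    proof
      fix j assume j: "j \<in> {j. j < length xs \<and> xs ! j \<le> ?k}"
      then have "\<not> i \<le> j"
        using * sorted_nth_mono[OF assms(1), of i j] by auto
      then show "j \<in> {..<i}" by simp
    qed
    then have "card {j. j < length xs \<and> xs ! j \<le> ?k} \<le> card {..<i}"
      by (intro card_mono) auto
    ultimately show False
      using le[of ?k] by (simp add: length_filter_conv_card)
  qed
qed (fact assms(3))

text \<open>By \<open>card_pairs_within\<close> larger ball sums mean more pairs at distance at most
  \<open>k\<close>, since the orders agree; sortedness turns this into a coordinatewise
  comparison.\<close>

lemma distance_sequence_dominated: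
  assumes "pair_graph G" "Digraph_Component.connected G" "pair_graph H" "Digraph_Component.connected H"
    and "card (pverts G) = card (pverts H)"
    and "\<And>k. (\<Sum>u\<in>pverts H. card (rball (parcs H) u k)) \<le> (\<Sum>u\<in>pverts G. card (rball (parcs G) u k))"
  shows "list_all2 (\<le>) (distance_sequence G) (distance_sequence H)"
proof (rule sorted_list_all2_le)
  show "sorted (distance_sequence G)" "sorted (distance_sequence H)"
    by (simp_all add: distance_sequence_def)
  show "length (distance_sequence G) = length (distance_sequence H)"
    using assms(5) by (simp add: length_distance_sequence assms(1,3))
  fix k
  show "length (filter (\<lambda>x. x \<le> k) (distance_sequence H)) \<le> length (filter (\<lambda>x. x \<le> k) (distance_sequence G))"
    using card_pairs_within[OF assms(1,2), of k] card_pairs_within[OF assms(3,4), of k] assms(5) assms(6)[of k]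
    by (simp add: length_filter_distance_sequence assms(1,3))
qed

text \<open>The coordinates are replaced one at a time from the left. The intermediate lists need
  not be sorted. The alternative \<open>xs = ys\<close> lets one statement cover strict and
  non-strict relations.\<close>

lemma coordinatewise_list_all2:
  assumes "coordinatewise R g" "transp R" "list_all2 (\<le>) xs ys" "\<forall>x\<in>set xs. 0 < x"
  shows "xs = ys \<or> R (g xs) (g ys)"
proof -
  have len: "length xs = length ys" using assms(3) by (rule list_all2_lengthD)
  have "xs = take k ys @ drop k xs \<or> R (g xs) (g (take k ys @ drop k xs))" if "k \<le> length xs" for k
    using that
  proof (induction k)
    case 0
    then show ?case by simp
  next
    case (Suc k)
    let ?z = "take k ys @ drop k xs"
    have upd: "take (Suc k) ys @ drop (Suc k) xs = ?z[k := ys ! k]"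
      using Suc.prems len by (simp add: take_Suc_conv_app_nth list_update_append Cons_nth_drop_Suc[symmetric])
    have zk: "?z ! k = xs ! k" using Suc.prems len by (simp add: nth_append)
    have le: "xs ! k \<le> ys ! k" using assms(3) Suc.prems by (simp add: list_all2_conv_all_nth)
    have "\<forall>y\<in>set ys. 0 < y"
      using assms(3,4) by (fastforce simp: list_all2_conv_all_nth in_set_conv_nth)
    then have pos: "\<forall>x\<in>set ?z. 0 < x"
      using assms(4) by (auto dest: in_set_takeD in_set_dropD)
    show ?case
    proof (cases "xs ! k = ys ! k")
      case True
      then have "take (Suc k) ys @ drop (Suc k) xs = ?z" using upd zk by (metis list_update_id)
      then show ?thesis using Suc by simp
    next
      case False
      then have "R (g ?z) (g (?z[k := ys ! k]))"
        using assms(1) pos zk le Suc.prems len unfolding coordinatewise_def by simp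
      then show ?thesis using Suc assms(2) upd by (metis Suc_leD transpE)
    qed
  qed
  from this[of "length xs"] show ?thesis using len by simp
qed

text \<open>Equal ball sums give domination in both directions.\<close>

lemma is_cycle_graph_distance_sequence:
  assumes "pair_graph G" "is_cycle_graph n G" "pair_graph H" "is_cycle_graph n H"
  shows "distance_sequence G = distance_sequence H"
proof -
  have "list_all2 (\<le>) (distance_sequence G) (distance_sequence H)"
    "list_all2 (\<le>) (distance_sequence H) (distance_sequence G)"
    using assms
    by (auto intro!: distance_sequence_dominated is_cycle_graph_connected
        simp: is_cycle_graph_card sum_card_rball_is_cycle_graph)
  then show ?thesis by (rule list_all2_antisym[rotated]) auto
qed

text \<open>The index \<open>I\<close> lives on graphs over \<open>'a\<close>, so the cycle enters
  as an arbitrary copy \<open>C\<close> over the same type.\<close>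

theorem theorem2:
  fixes G C :: "'a pair_pre_digraph" and I :: "'a pair_pre_digraph \<Rightarrow> real" and \<kappa> n :: nat
  assumes "0 < \<kappa>" and "even \<kappa>"
    and "pair_graph G" and "k_connected \<kappa> G" and "card (pverts G) = n"
    and "pair_graph C" and "is_cycle_graph n C"
  shows "(nondecreasing_index I \<longrightarrow> I G \<le> I (graph_power C (\<kappa> div 2)))
    \<and> (\<kappa> = 2 \<and> increasing_index I \<longrightarrow>
         I G \<le> I (graph_power C (\<kappa> div 2)) \<and>
         (I G = I (graph_power C (\<kappa> div 2)) \<longleftrightarrow> (\<exists>m. is_cycle_graph m G)))
    \<and> (nonincreasing_index I \<longrightarrow> I G \<ge> I (graph_power C (\<kappa> div 2)))
    \<and> (\<kappa> = 2 \<and> decreasing_index I \<longrightarrow>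
         I G \<ge> I (graph_power C (\<kappa> div 2)) \<and>
         (I G = I (graph_power C (\<kappa> div 2)) \<longleftrightarrow> (\<exists>m. is_cycle_graph m G)))"
proof -
  interpret pair_graph G by fact
  define h where "h = \<kappa> div 2"
  have h: "0 < h" "2 * h = \<kappa>" using assms(1,2) by (auto simp: h_def)
  let ?P = "graph_power C h"
  let ?xs = "distance_sequence G" and ?ys = "distance_sequence ?P"
  have n: "3 \<le> n" using assms(7) by (simp add: is_cycle_graph_def)
  have conG: "Digraph_Component.connected G"
    using assms(3,4,1) by (rule k_connected_imp_connected)
  have conC: "Digraph_Component.connected C"
    using assms(6,7) by (rule is_cycle_graph_connected)
  have P: "pair_graph ?P" using assms(6) by (rule pair_graph_graph_power)
  have conP: "Digraph_Component.connected ?P"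
    using assms(6) conC h(1) by (rule connected_graph_power)
  have VP: "pverts ?P = pverts C" by (simp add: graph_power_def)
  have cardC: "card (pverts C) = n" using assms(7) by (rule is_cycle_graph_card)
  have finC: "finite (pverts C)" using cardC n by (intro card_ge_0_finite) simp
  have lower: "min n (1 + k * \<kappa>) \<le> card (rball (parcs G) u k)" if "u \<in> pverts G" for u k
    using k_connected_card_rball[OF assms(3,4) that, of k] assms(5) by simp
  have upper: "card (rball (parcs ?P) u k) \<le> min n (1 + k * \<kappa>)" if u: "u \<in> pverts C" for u k
  proof -
    have "rball (parcs ?P) u k \<subseteq> pverts C"
      using rball_subset_verts[OF pair_graph.parcs_subset[OF P]] u VP by simp
    then have "card (rball (parcs ?P) u k) \<le> n"
      using card_mono[OF finC] cardC by metis
    \<comment> \<open>Radius \<open>k\<close> in the power lies within radius \<open>h * k\<close>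
      in the cycle, whose balls have at most \<open>1 + 2 * h * k\<close> vertices, that is,
      \<open>1 + k * \<kappa>\<close>.\<close>
    moreover have "card (rball (parcs ?P) u k) \<le> card (rball (parcs C) u (h * k))"
      using rball_subset_verts[OF pair_graph.parcs_subset[OF assms(6)] u] finC
      by (intro card_mono rball_graph_power[OF assms(6) u]) (rule finite_subset)
    moreover have "card (rball (parcs C) u (h * k)) \<le> 1 + k * \<kappa>"
      using is_cycle_graph_card_rball[OF assms(7) u, of "h * k"] by (simp add: h(2)[symmetric] ac_simps)
    ultimately show ?thesis by simp
  qed
  have sumP: "(\<Sum>u\<in>pverts ?P. card (rball (parcs ?P) u k)) \<le> n * min n (1 + k * \<kappa>)" for k
    unfolding VP cardC[symmetric]
    using sum_bounded_above[of "pverts C" "\<lambda>u. card (rball (parcs ?P) u k)"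
        "min (card (pverts C)) (1 + k * \<kappa>)"] upper cardC by simp
  have sumG: "n * min n (1 + k * \<kappa>) \<le> (\<Sum>u\<in>pverts G. card (rball (parcs G) u k))" for k
    using sum_bounded_below[of "pverts G" "min n (1 + k * \<kappa>)" "\<lambda>u. card (rball (parcs G) u k)"]
      lower assms(5) by simp
  have dom: "list_all2 (\<le>) ?xs ?ys"
    using assms(3) conG P conP
  proof (rule distance_sequence_dominated)
    show "card (pverts G) = card (pverts ?P)" using assms(5) cardC VP by simp
    show "(\<Sum>u\<in>pverts ?P. card (rball (parcs ?P) u k)) \<le> (\<Sum>u\<in>pverts G. card (rball (parcs G) u k))" for k
      using sumP sumG by (rule le_trans)
  qed
  have pos: "\<forall>x\<in>set ?xs. 0 < x" using distance_sequence_pos[OF assms(3) conG] by blast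
  \<comment> \<open>This dichotomy is instantiated with all four order relations below.\<close>
  have key: "?xs = ?ys \<or> R (g ?xs) (g ?ys)" if "coordinatewise R g" "transp R" for R g
    using that dom pos by (rule coordinatewise_list_all2)
  have I: "I G = g ?xs" "I ?P = g ?ys" if "represents_index g I" for g
    using that assms(3) conG P conP by (auto simp: represents_index_def)
  have eq_iff: "?xs = ?ys \<longleftrightarrow> (\<exists>m. is_cycle_graph m G)" if "\<kappa> = 2"
  proof
    assume "?xs = ?ys"
    \<comment> \<open>Equal sequences contain equally many ones, so the sums over balls of radius 1
      agree.\<close>
    then have sums: "(\<Sum>u\<in>pverts G. card (rball (parcs G) u 1)) = (\<Sum>u\<in>pverts ?P. card (rball (parcs ?P) u 1))"
      using card_pairs_within[OF assms(3) conG, of 1] card_pairs_within[OF P conP, of 1]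
        length_filter_distance_sequence[OF assms(3), of "\<lambda>x. x \<le> 1"]
        length_filter_distance_sequence[OF P, of "\<lambda>x. x \<le> 1"] assms(5) cardC VP by simp
    have low3: "3 \<le> card (rball (parcs G) u 1)" if "u \<in> pverts G" for u
      using lower[OF that, of 1] n \<open>\<kappa> = 2\<close> by simp
    have "(\<Sum>u\<in>pverts G. card (rball (parcs G) u 1)) \<le> (\<Sum>u\<in>pverts G. 3)"
      using sums sumP[of 1] n \<open>\<kappa> = 2\<close> assms(5) by simp
    \<comment> \<open>Every term is at least 3 while the sum is at most \<open>3 * n\<close>, so
      every term is exactly 3 and every degree is 2.\<close>
    then have sum3: "(\<Sum>u\<in>pverts G. card (rball (parcs G) u 1)) = (\<Sum>u\<in>pverts G. 3)"
      by (rule antisym) (intro sum_mono low3)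
    have ball3: "card (rball (parcs G) u 1) = 3" if "u \<in> pverts G" for u
      by (rule sum_mono_inv[OF sum3[symmetric] low3 that pair_finite_verts, symmetric])
    have "card (parcs G `` {u}) = 2" if u: "u \<in> pverts G" for u
    proof -
      have "rball (parcs G) u 1 = insert u (parcs G `` {u})" by auto
      moreover have "u \<notin> parcs G `` {u}" using no_loops' by auto
      moreover have "finite (parcs G `` {u})"
        by (rule finite_subset[OF _ pair_finite_verts]) (auto dest: in_arcsD2)
      ultimately show ?thesis using ball3[OF u] by simp
    qed
    then show "\<exists>m. is_cycle_graph m G"
      using two_regular_connected_is_cycle_graph[OF assms(3) conG] by blast
  next
    assume "\<exists>m. is_cycle_graph m G"
    \<comment> \<open>The order of \<open>G\<close> forces \<open>m = n\<close>.\<close>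
    then have "is_cycle_graph n G" using is_cycle_graph_card assms(5) by metis
    then have "?xs = distance_sequence C"
      using assms(3,6,7) is_cycle_graph_distance_sequence by blast
    moreover have "?P = C" using graph_power_1[OF assms(6)] that h(2) by simp
    ultimately show "?xs = ?ys" by simp
  qed
  have "I G \<le> I ?P" if "nondecreasing_index I"
  proof -
    obtain g where g: "represents_index g I" "coordinatewise (\<le>) g"
      using \<open>nondecreasing_index I\<close> unfolding nondecreasing_index_def by blast
    show ?thesis
      using key[OF g(2) transp_on_le] I[OF g(1)] by auto
  qed
  \<comment> \<open>For a strict relation the second alternative of \<open>key\<close> excludes
    equal index values, so these agree exactly when the sequences do.\<close>
  moreover have "I G \<le> I ?P \<and> (I G = I ?P \<longleftrightarrow> ?xs = ?ys)" if "increasing_index I"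
  proof -
    obtain g where g: "represents_index g I" "coordinatewise (<) g"
      using \<open>increasing_index I\<close> unfolding increasing_index_def by blast
    show ?thesis
      using key[OF g(2) transp_on_less] I[OF g(1)] by auto
  qed
  moreover have "I G \<ge> I ?P" if "nonincreasing_index I"
  proof -
    obtain g where g: "represents_index g I" "coordinatewise (\<ge>) g"
      using \<open>nonincreasing_index I\<close> unfolding nonincreasing_index_def by blast
    show ?thesis
      using key[OF g(2) transp_on_ge] I[OF g(1)] by auto
  qed
  moreover have "I G \<ge> I ?P \<and> (I G = I ?P \<longleftrightarrow> ?xs = ?ys)" if "decreasing_index I"
  proof -
    obtain g where g: "represents_index g I" "coordinatewise (>) g"
      using \<open>decreasing_index I\<close> unfolding decreasing_index_def by blast
    show ?thesis
      using key[OF g(2) transp_on_greater] I[OF g(1)] by auto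
  qed
  ultimately show ?thesis using eq_iff unfolding h_def by blast
qed

end
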